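(* Let $n\geq 2$. The set $\mathscr{C}=\{E_{p,q}+E_{q,p} : 1\le p<q\le n\}\cup\{E_{p,q}-E_{q,p} : 1\le p<q\le n\}$ of traceless matrices is a Lie algebra generating set for $\mathfrak{sl}(n,\mathbb{R})$; that is, the smallest Lie subalgebra of $\mathfrak{sl}(n,\mathbb{R})$ containing $\mathscr{C}$ is $\mathfrak{sl}(n,\mathbb{R})$ itself.
   Context: $\mathfrak{sl}(n,\mathbb{R})$ is the Lie algebra of real traceless $n\times n$ matrices with bracket $[X,Y]=XY-YX$. $E_{i,j}$ is the $n\times n$ matrix with a $1$ in position $(i,j)$ and zeros elsewhere. *)

theory Defs
  imports "HOL-Analysis.Analysis"
begin

text \<open>
  Matrices are indexed by a finite linearly ordered type \<open>'n\<close>, which plays the role of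
  \<open>{1, ..., n}\<close> with \<open>n = CARD('n)\<close>; the order is what \<open>p < q\<close> refers to.
  The type-class multiplication on \<open>real ^ 'n ^ 'n\<close> is componentwise, so the matrix
  product has to be written \<open>**\<close>.
\<close>

definition matrix_unit :: "'n::finite \<Rightarrow> 'n \<Rightarrow> real ^ 'n ^ 'n" where
  "matrix_unit p q = (\<chi> i j. if i = p \<and> j = q then 1 else 0)"

definition lie_bracket :: "real ^ 'n::finite ^ 'n \<Rightarrow> real ^ 'n ^ 'n \<Rightarrow> real ^ 'n ^ 'n" where
  "lie_bracket X Y = X ** Y - Y ** X"

definition sl :: "(real ^ 'n::finite ^ 'n) set" where
  "sl = {X. trace X = 0}"

definition lie_subalgebra :: "(real ^ 'n::finite ^ 'n) set \<Rightarrow> (real ^ 'n ^ 'n) set \<Rightarrow> bool" where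
  "lie_subalgebra G L \<longleftrightarrow>
     L \<subseteq> G \<and> subspace L \<and> (\<forall>X\<in>L. \<forall>Y\<in>L. lie_bracket X Y \<in> L)"

lemma lie_subalgebra_sl: "lie_subalgebra sl (sl :: (real ^ 'n::finite ^ 'n) set)"
proof -
  have "trace (c *\<^sub>R X) = c * trace X" for c and X :: "real ^ 'n ^ 'n"
    unfolding trace_def sum_distrib_left by simp
  moreover have "trace (X ** Y - Y ** X) = 0" for X Y :: "real ^ 'n ^ 'n"
    by (simp only: trace_sub trace_mul_sym[of X Y] diff_self)
  ultimately show ?thesis
    unfolding lie_subalgebra_def sl_def lie_bracket_def subspace_def
    by (simp add: trace_add) (simp add: trace_def)
qed

text \<open>
  \<open>hull\<close> is the intersection of all Lie subalgebras of \<open>G\<close> containing \<open>S\<close>. It is itself the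
  smallest such subalgebra as soon as there is one; the inclusion \<open>S \<subseteq> G\<close> is demanded
  separately because without it the intersection ranges over the empty family.
\<close>

definition lie_generated :: "(real ^ 'n::finite ^ 'n) set \<Rightarrow> (real ^ 'n ^ 'n) set \<Rightarrow> (real ^ 'n ^ 'n) set" where
  "lie_generated G S = lie_subalgebra G hull S"

definition lie_generating_set :: "(real ^ 'n::finite ^ 'n) set \<Rightarrow> (real ^ 'n ^ 'n) set \<Rightarrow> bool" where
  "lie_generating_set G S \<longleftrightarrow> S \<subseteq> G \<and> lie_generated G S = G"

lemma lie_subalgebra_generated:
  assumes "S \<subseteq> sl"
  shows "lie_subalgebra sl (lie_generated sl S)"
proof -
  have sub: "lie_generated sl S \<subseteq> sl"
    unfolding lie_generated_def by (intro hull_minimal assms lie_subalgebra_sl)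
  then show ?thesis
    unfolding lie_subalgebra_def lie_generated_def hull_def subspace_def by blast
qed

definition gen_set_C :: "(real ^ 'n::{finite,linorder} ^ 'n::{finite,linorder}) set" where
  "gen_set_C = {matrix_unit p q + matrix_unit q p | p q. p < q} \<union>
               {matrix_unit p q - matrix_unit q p | p q. p < q}"

end

theory Submission
  imports Defs
begin

text \<open>
  Half the sum and half the difference of the two generators for \<open>p < q\<close> are the off-diagonal
  matrix units, and \<open>[E\<^sub>p\<^sub>q, E\<^sub>q\<^sub>p] = E\<^sub>p\<^sub>p - E\<^sub>q\<^sub>q\<close>. For a fixed index \<open>r\<close>, a traceless \<open>X\<close> is
  the combination of the \<open>E\<^sub>p\<^sub>q\<close> with \<open>p \<noteq> q\<close> and the \<open>E\<^sub>p\<^sub>p - E\<^sub>r\<^sub>r\<close>, with the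
  entries of \<open>X\<close> as coefficients.
\<close>

lemma matrix_unit_nth: "matrix_unit p q $ i $ j = (if i = p \<and> j = q then 1 else 0)"
  by (simp add: matrix_unit_def)

lemma matrix_unit_mult:
  "matrix_unit p q ** matrix_unit r s = (if q = r then matrix_unit p s else 0)"
proof -
  \<comment> \<open>With the condition on \<open>k\<close> isolated, the sum collapses to its single
    term at \<open>k = q\<close>.\<close>
  have "(\<Sum>k\<in>UNIV. matrix_unit p q $ i $ k * matrix_unit r s $ k $ j) =
      (\<Sum>k\<in>UNIV. if k = q then (if i = p \<and> q = r \<and> j = s then 1 else 0) else 0)" for i j
    by (intro sum.cong) (auto simp: matrix_unit_nth)
  then show ?thesis
    by (auto simp: vec_eq_iff matrix_matrix_mult_def matrix_unit_nth)
qed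

lemma trace_matrix_unit: "trace (matrix_unit p q) = (if p = q then 1 else 0)"
proof -
  have "(\<Sum>k\<in>UNIV. matrix_unit p q $ k $ k) = (\<Sum>k\<in>UNIV. if k = p then (if p = q then 1 else 0) else 0)"
    by (intro sum.cong) (auto simp: matrix_unit_nth)
  then show ?thesis
    by (simp add: trace_def)
qed

text \<open>Subtracting \<open>matrix_unit r r\<close> from each diagonal unit changes only the
  entry at (r, r), by the trace of \<open>X\<close>, which is zero. The summand for
  \<open>p = q = r\<close> vanishes, so the sum can run over all pairs of indices.\<close>

lemma traceless_expansion:
  fixes X :: "real ^ 'n::finite ^ 'n"
  assumes "trace X = 0"
  shows "X = (\<Sum>p\<in>UNIV. \<Sum>q\<in>UNIV. X $ p $ q *\<^sub>R
    (if p = q then matrix_unit p p - matrix_unit r r else matrix_unit p q))"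
    (is "X = ?S")
proof -
  have "?S $ i $ j = X $ i $ j" for i j
  proof -
    let ?d = "if i = r \<and> j = r then 1 else 0 :: real"
    \<comment> \<open>The first part of the summand picks out the entry at (i, j); the second lives
      on the diagonal \<open>q = p\<close> and adds up to the trace.\<close>
    have "?S $ i $ j = (\<Sum>p\<in>UNIV. \<Sum>q\<in>UNIV.
        (if q = j then (if p = i then X $ i $ j else 0) else 0) - (if q = p then X $ p $ p * ?d else 0))"
      unfolding sum_component by (intro sum.cong) (auto simp: matrix_unit_nth)
    also have "\<dots> = X $ i $ j - trace X * ?d"
      by (simp add: sum_subtractf trace_def sum_distrib_right)
    finally show ?thesis
      using assms by simp
  qed
  then show ?thesis
    by (simp add: vec_eq_iff)
qed

lemma sl_subset_lie_subalgebra: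
  fixes L :: "(real ^ 'n::finite ^ 'n) set"
  assumes L: "lie_subalgebra G L"
    and off: "\<And>p q. p \<noteq> q \<Longrightarrow> matrix_unit p q \<in> L"
  shows "sl \<subseteq> L"
proof
  fix X :: "real ^ 'n ^ 'n"
  assume "X \<in> sl"
  then have X: "trace X = 0"
    by (simp add: sl_def)
  have sub: "subspace L"
    and br: "\<And>Y Z. Y \<in> L \<Longrightarrow> Z \<in> L \<Longrightarrow> lie_bracket Y Z \<in> L"
    using L by (auto simp: lie_subalgebra_def)
  \<comment> \<open>The case \<open>p = q\<close> is included because the expansion contains the
    zero term at \<open>p = r\<close>.\<close>
  have diag: "matrix_unit p p - matrix_unit q q \<in> L" for p q
  proof (cases "p = q")
    case True
    then show ?thesis
      using subspace_0[OF sub] by simp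
  next
    case False
    then show ?thesis
      using br[OF off off, of p q q p] by (simp add: lie_bracket_def matrix_unit_mult)
  qed
  \<comment> \<open>Any index can serve as \<open>r\<close>; \<open>undefined\<close> names
    one.\<close>
  show "X \<in> L"
    by (subst traceless_expansion[OF X, of undefined])
      (auto intro!: subspace_sum subspace_scale sub diag off)
qed

lemma matrix_unit_in_subspace:
  fixes L :: "(real ^ 'n::{finite,linorder} ^ 'n::{finite,linorder}) set"
  assumes sub: "subspace L" and C: "gen_set_C \<subseteq> L" and "p \<noteq> q"
  shows "matrix_unit p q \<in> L"
proof -
  \<comment> \<open>The generators are indexed by \<open>a < b\<close> only, so both units of a pair
    are extracted at once; this covers \<open>p < q\<close> and \<open>q < p\<close>.\<close>
  have *: "matrix_unit a b \<in> L \<and> matrix_unit b a \<in> L" if "a < b" for a b :: 'n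
  proof -
    let ?P = "matrix_unit a b + matrix_unit b a" and ?M = "matrix_unit a b - matrix_unit b a"
    have "?P \<in> L" "?M \<in> L"
      using C that by (auto simp: gen_set_C_def)
    then have "(1/2) *\<^sub>R (?P + ?M) \<in> L" "(1/2) *\<^sub>R (?P - ?M) \<in> L"
      by (blast intro: subspace_scale subspace_add subspace_diff sub)+
    moreover have "(1/2) *\<^sub>R (?P + ?M) = matrix_unit a b" "(1/2) *\<^sub>R (?P - ?M) = matrix_unit b a"
      by (simp_all add: vec_eq_iff)
    ultimately show ?thesis
      by simp
  qed
  show ?thesis
    using *[of p q] *[of q p] \<open>p \<noteq> q\<close> by (cases p q rule: linorder_cases) auto
qed

theorem theorem3p4:
  assumes "CARD('n::{finite,linorder}) \<ge> 2"
  shows "lie_generating_set sl (gen_set_C :: (real ^ 'n::{finite,linorder} ^ 'n::{finite,linorder}) set)"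
proof -
  let ?C = "gen_set_C :: (real ^ 'n::{finite,linorder} ^ 'n::{finite,linorder}) set"
  have C: "?C \<subseteq> sl"
    by (auto simp: gen_set_C_def sl_def trace_add trace_sub trace_matrix_unit)
  \<comment> \<open>The hull is itself a Lie subalgebra, so it can take the place of
    \<open>L\<close> in both preceding lemmas.\<close>
  have L: "lie_subalgebra sl (lie_generated sl ?C)"
    by (rule lie_subalgebra_generated[OF C])
  then have sub: "subspace (lie_generated sl ?C)" and "lie_generated sl ?C \<subseteq> sl"
    by (auto simp: lie_subalgebra_def)
  moreover have "?C \<subseteq> lie_generated sl ?C"
    unfolding lie_generated_def by (rule hull_subset)
  then have "sl \<subseteq> lie_generated sl ?C"
    using sl_subset_lie_subalgebra[OF L] matrix_unit_in_subspace[OF sub] by blast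
  ultimately show ?thesis
    using C by (auto simp: lie_generating_set_def)
qed

end
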